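(* Let $\bar x\in\mathrm{dom}\,f$ be a local minimizer of the proper extended real function $f:\mathbb{E}\to\mathbb{R}\cup\{+\infty\}$. Then \[ 0\in\partial^{(1)}_- f(\bar x),\qquad 0\in\partial^{(n)}_- f(\bar x;\underbrace{0,0,\dots,0}_{(n-1)\text{ times}})\quad\text{for all } n=2,3,4,\dots \]
   Context: $\mathbb{E}$ is a real finite-dimensional Euclidean space. $L^1(\mathbb{E})=L(\mathbb{E},\mathbb{R})$ is the space of continuous linear functionals, and $L^n(\mathbb{E})=L(\mathbb{E},L^{n-1}(\mathbb{E}))$ for $n>1$. A function $f:\mathbb{E}\to\mathbb{R}\cup\{+\infty\}$ is called a proper extended real function (it never takes the value $-\infty$), and $\mathrm{dom}\,f=\{x\in\mathbb{E}\mid f(x)<+\infty\}$. For $x\in\mathrm{dom}\,f$ and $u\in\mathbb{E}$, the lower Hadamard directional derivative is \[ f^{(1)}_-(x;u)=\liminf_{t\downarrow 0,\,u'\to u} t^{-1}[f(x+tu')-f(x)] \] (here $t\to0$ through positive values and $\|u'-u\|\to 0$), and the lower Hadamard subdifferential is $\partial^{(1)}_- f(x)=\{x^*\in L^1(\mathbb{E})\mid x^*(u)\le f^{(1)}_-(x;u)\ \forall u\in\mathbb{E}\}$. Recursively, for an integer $n\ge2$, given $x_1^*\in\partial^{(1)}_- f(x)$ and $x_i^*\in\partial^{(i)}_- f(x;x_1^*,\dots,x_{i-1}^* )$ for $i=2,\dots,n-1$, the lower derivative of Hadamard type of order $n$ is the element of $[-\infty,+\infty]$ \[ f^{(n)}_-(x;x_1^*,\dots,x_{n-1}^*;u)=\liminf_{t\downarrow0,\,u'\to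 u} n!\,t^{-n}\Big[f(x+tu')-f(x)-\sum_{i=1}^{n-1}\frac{t^i}{i!}\,x_i^*\underbrace{(u')\dots(u')}_{i\text{ times}}\Big], \] and the lower subdifferential of Hadamard type of order $n$ is \[ \partial^{(n)}_- f(x;x_1^*,\dots,x_{n-1}^* )=\{x^*\in L^n(\mathbb{E})\mid x^*\underbrace{(u)\dots(u)}_{n\text{ times}}\le f^{(n)}_-(x;x_1^*,\dots,x_{n-1}^*;u)\ \forall u\in\mathbb{E}\}. \] *)

theory Defs
  imports "HOL-Analysis.Analysis"
begin

definition proper_fun :: "('a \<Rightarrow> ereal) \<Rightarrow> bool" where
  "proper_fun f \<longleftrightarrow> (\<forall>x. f x \<noteq> -\<infinity>)"

definition eff_dom :: "('a \<Rightarrow> ereal) \<Rightarrow> 'a set" where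
  "eff_dom f = {x. f x < \<infinity>}"

definition local_minimizer :: "('a::topological_space \<Rightarrow> ereal) \<Rightarrow> 'a \<Rightarrow> bool" where
  "local_minimizer f x \<longleftrightarrow> (\<forall>\<^sub>F y in nhds x. f x \<le> f y)"

text \<open>
  The iterated spaces \<open>L\<^sup>n(E) = L(E, L\<^sup>n\<^sup>-\<^sup>1(E))\<close> have a different HOL type for each \<open>n\<close>, so an
  element \<open>T\<close> of \<open>L\<^sup>n(E)\<close> is represented in uncurried form by a function on lists:
  \<open>T(u\<^sub>1)(u\<^sub>2)\<dots>(u\<^sub>n)\<close> is written \<open>T [u\<^sub>1, u\<^sub>2, \<dots>, u\<^sub>n]\<close>, and \<open>T\<close> vanishes on lists of any other
  length, which makes the representation unique. Application of \<open>T\<close> to a first argument \<open>u\<close> gives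
  \<open>\<lambda>vs. T (u # vs)\<close>. No symmetry is required. Requiring \<open>u \<mapsto> T(u)\<close> to be linear and continuous
  after evaluation at each \<open>vs\<close> is the same as requiring it for the map into \<open>L\<^sup>n\<^sup>-\<^sup>1(E)\<close>, since
  \<open>E\<close> is finite-dimensional. The case \<open>n = 0\<close> stands for the scalars.
\<close>
primrec iterated_dual :: "nat \<Rightarrow> ('a::euclidean_space list \<Rightarrow> real) set" where
  "iterated_dual 0 = {T. \<forall>vs. vs \<noteq> [] \<longrightarrow> T vs = 0}"
| "iterated_dual (Suc n) =
    {T. T [] = 0 \<and>
        (\<forall>u. (\<lambda>vs. T (u # vs)) \<in> iterated_dual n) \<and>
        (\<forall>vs. bounded_linear (\<lambda>u. T (u # vs)))}"

text \<open>
  In the following definitions \<open>xs = [x\<^sub>1\<^sup>*, \<dots>, x\<^sub>n\<^sub>-\<^sub>1\<^sup>*]\<close>, so the order is \<open>n = length xs + 1\<close> and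
  the empty list gives the first-order notions. The argument \<open>u'\<close> ranges over full neighbourhoods
  of \<open>u\<close>, that is, \<open>u' = u\<close> is allowed.
\<close>
definition hadamard_lower_deriv ::
  "('a::euclidean_space \<Rightarrow> ereal) \<Rightarrow> 'a \<Rightarrow> ('a list \<Rightarrow> real) list \<Rightarrow> 'a \<Rightarrow> ereal" where
  "hadamard_lower_deriv f x xs u =
    (let n = length xs + 1 in
      Liminf (at_right 0 \<times>\<^sub>F nhds u)
        (\<lambda>(t, u'). ereal (fact n / t ^ n) *
          (f (x + t *\<^sub>R u') - f x
            - ereal (\<Sum>i = 1..n - 1. t ^ i / fact i * (xs ! (i - 1)) (replicate i u')))))"

definition hadamard_lower_subdiff ::
  "('a::euclidean_space \<Rightarrow> ereal) \<Rightarrow> 'a \<Rightarrow> ('a list \<Rightarrow> real) list \<Rightarrow> ('a list \<Rightarrow> real) set" where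
  "hadamard_lower_subdiff f x xs =
    (let n = length xs + 1 in
      {T \<in> iterated_dual n. \<forall>u. ereal (T (replicate n u)) \<le> hadamard_lower_deriv f x xs u})"

text \<open>
  The notions of order \<open>length xs + 1\<close> are only meant for lists \<open>xs\<close> that satisfy the following
  condition: \<open>x\<^sub>1\<^sup>*\<close> is a first-order subgradient and each \<open>x\<^sub>i\<^sup>*\<close> is a subgradient of order \<open>i\<close> with
  respect to \<open>x\<^sub>1\<^sup>*, \<dots>, x\<^sub>i\<^sub>-\<^sub>1\<^sup>*\<close>.
\<close>
definition subgradient_chain ::
  "('a::euclidean_space \<Rightarrow> ereal) \<Rightarrow> 'a \<Rightarrow> ('a list \<Rightarrow> real) list \<Rightarrow> bool" where
  "subgradient_chain f x xs \<longleftrightarrow>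
    (\<forall>i < length xs. xs ! i \<in> hadamard_lower_subdiff f x (take i xs))"

lemma iterated_dual_1:
  "iterated_dual 1 =
    {T. \<exists>\<phi>. bounded_linear \<phi> \<and> T = (\<lambda>vs. case vs of [u] \<Rightarrow> \<phi> u | _ \<Rightarrow> 0)}" (is "?L = ?R")
proof
  show "?L \<subseteq> ?R"
  proof
    fix T :: "'a list \<Rightarrow> real"
    assume T: "T \<in> ?L"
    then have "bounded_linear (\<lambda>u. T [u])" by simp
    moreover have "T = (\<lambda>vs. case vs of [u] \<Rightarrow> T [u] | _ \<Rightarrow> 0)"
      using T by (auto simp: fun_eq_iff split: list.split)
    ultimately show "T \<in> ?R" by blast
  qed
  show "?R \<subseteq> ?L"
  proof
    fix T :: "'a list \<Rightarrow> real"
    assume "T \<in> ?R"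
    then obtain \<phi> where "bounded_linear \<phi>" and T: "T = (\<lambda>vs. case vs of [u] \<Rightarrow> \<phi> u | _ \<Rightarrow> 0)"
      by blast
    then have "bounded_linear (\<lambda>u. T (u # vs))" for vs
      by (cases vs) (simp_all add: bounded_linear_zero)
    then show "T \<in> ?L"
      by (simp add: T split: list.split)
  qed
qed

lemma hadamard_lower_deriv_Nil:
  "hadamard_lower_deriv f x [] u =
    Liminf (at_right 0 \<times>\<^sub>F nhds u) (\<lambda>(t, u'). ereal (1 / t) * (f (x + t *\<^sub>R u') - f x))"
  by (simp add: hadamard_lower_deriv_def zero_ereal_def[symmetric])

end

theory Submission
  imports Defs
begin

text \<open>
  If all the lower-order subgradients are \<open>0\<close>, the Taylor-type polynomial that is subtracted in the
  difference quotient of order \<open>n\<close> vanishes, so the quotient is \<open>n! t\<^sup>-\<^sup>n (f (x + t u') - f x)\<close>.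
  As \<open>t\<close> decreases to \<open>0\<close> and \<open>u'\<close> tends to \<open>u\<close>, the points \<open>x + t u'\<close> tend to \<open>x\<close>
  (\<open>filterlim_ray_points\<close>), hence they eventually lie in the neighbourhood on which the local minimizer
  \<open>x\<close> is optimal, and the quotient is nonnegative there. Its lower limit is therefore nonnegative
  in every direction, which says that the zero form is a subgradient of order \<open>n\<close>
  (\<open>zero_in_hadamard_lower_subdiff\<close>). Since this holds for each order separately, the zero forms
  make up an admissible chain, without an induction on \<open>n\<close>.
\<close>

lemma zero_in_iterated_dual: "(\<lambda>_. 0) \<in> iterated_dual n"
  by (induction n) (simp_all add: bounded_linear_zero)

lemma filterlim_ray_points:
  fixes x u :: "'a::real_normed_vector"
  shows "((\<lambda>(t, u'). x + t *\<^sub>R u') \<longlongrightarrow> x) (at_right 0 \<times>\<^sub>F nhds u)"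
proof -
  have fst_lim: "(fst \<longlongrightarrow> (0::real)) (at_right 0 \<times>\<^sub>F nhds u)"
    by (rule filterlim_mono[OF filterlim_fst _ order_refl]) (simp add: at_within_def)
  have "((\<lambda>p. x + fst p *\<^sub>R snd p) \<longlongrightarrow> x + 0 *\<^sub>R u) (at_right 0 \<times>\<^sub>F nhds u)"
    by (intro tendsto_intros fst_lim filterlim_snd)
  then show ?thesis
    by (simp add: case_prod_unfold)
qed

lemma zero_in_hadamard_lower_subdiff:
  fixes f :: "'a::euclidean_space \<Rightarrow> ereal"
  assumes "local_minimizer f x"
  shows "(\<lambda>_. 0) \<in> hadamard_lower_subdiff f x (replicate k (\<lambda>_. 0))"
proof -
  have "0 \<le> hadamard_lower_deriv f x (replicate k (\<lambda>_. 0)) u" for u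
  proof -
    have poly: "(\<Sum>i = 1..k. t ^ i / fact i * (replicate k (\<lambda>_. 0) ! (i - 1)) (replicate i u')) = 0"
      for t :: real and u' :: 'a
      by (rule sum.neutral) auto
    have "\<forall>\<^sub>F p in at_right 0 \<times>\<^sub>F nhds u. f x \<le> f (case p of (t, u') \<Rightarrow> x + t *\<^sub>R u')"
      by (rule eventually_compose_filterlim[OF assms[unfolded local_minimizer_def]
            filterlim_ray_points])
    moreover have "\<forall>\<^sub>F p in at_right 0 \<times>\<^sub>F nhds u. (0::real) < fst p"
      by (rule eventually_compose_filterlim[OF eventually_at_right_less filterlim_fst])
    ultimately have "\<forall>\<^sub>F p in at_right 0 \<times>\<^sub>F nhds u.
        0 \<le> (case p of (t, u') \<Rightarrow> ereal (fact (k + 1) / t ^ (k + 1)) * (f (x + t *\<^sub>R u') - f x))"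
    proof eventually_elim
      case (elim p)
      obtain t u' where p: "p = (t, u')"
        by fastforce
      \<comment> \<open>This includes the value \<open>f (x + t u') = \<infinity>\<close>: a difference of extended reals with minuend
        \<open>\<infinity>\<close> is \<open>\<infinity>\<close>.\<close>
      have "0 \<le> f (x + t *\<^sub>R u') - f x"
        using elim(1) by (simp add: p ereal_diff_positive)
      moreover have "0 \<le> ereal (fact (k + 1) / t ^ (k + 1))"
        using elim(2) by (simp add: p)
      ultimately show ?case
        by (simp add: p)
    qed
    then show ?thesis
      unfolding hadamard_lower_deriv_def Let_def length_replicate diff_add_inverse2 poly
        zero_ereal_def[symmetric] ereal_minus(7) by (rule Liminf_bounded)
  qed
  then show ?thesis
    by (simp add: hadamard_lower_subdiff_def zero_in_iterated_dual zero_ereal_def[symmetric]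
        del: iterated_dual.simps)
qed

theorem theorem3p1:
  fixes f :: "'a::euclidean_space \<Rightarrow> ereal" and xbar :: 'a
  assumes "proper_fun f"
    and "xbar \<in> eff_dom f"
    and "local_minimizer f xbar"
  shows "(\<lambda>_. 0) \<in> hadamard_lower_subdiff f xbar [] \<and>
    (\<forall>n\<ge>2. subgradient_chain f xbar (replicate (n - 1) (\<lambda>_. 0)) \<and>
           (\<lambda>_. 0) \<in> hadamard_lower_subdiff f xbar (replicate (n - 1) (\<lambda>_. 0)))"
proof -
  have zero: "(\<lambda>_. 0) \<in> hadamard_lower_subdiff f xbar (replicate k (\<lambda>_. 0))" for k
    using assms(3) by (rule zero_in_hadamard_lower_subdiff)
  have "subgradient_chain f xbar (replicate k (\<lambda>_. 0))" for k
    by (simp add: subgradient_chain_def zero)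
  then show ?thesis
    using zero[of 0] by (simp add: zero)
qed

end
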